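(* Let $a,b>-1$ with $\alpha:=a+b>-1$. For integers $n\ge0$ let $$\pi_n=\sqrt{2n+\alpha+1}\,\sqrt{\frac{\Gamma(a+n+1)}{\Gamma(b+n+1)}},\qquad \eta_n=\sqrt{2n+\alpha+1}\,\sqrt{\frac{\Gamma(b+n+1)}{\Gamma(a+n+1)}}.$$ Then the biorthonormal polynomials $p_n,q_n$, normalized to have identical positive leading coefficients (see context), are given by $$p_n(z)=(-1)^n\pi_n\,\widetilde p_n(z),\qquad q_n(z)=(-1)^n\eta_n\,\widetilde q_n(z).$$ Moreover, $$\pi_n=\int_0^\infty x^ae^{-x}p_n(x)\,dx,\qquad \eta_n=\int_0^\infty y^be^{-y}q_n(y)\,dy.$$
   Context: $p_n,q_n$ are the polynomials of exact degree $n$, with $p_n(x)=c_nx^n+\dots$, $q_n(y)=c_ny^n+\dots$, $c_n>0$, such that $$\int_0^\infty\!\!\int_0^\infty\frac{x^ay^be^{-x-y}}{x+y}p_\ell(x)q_m(y)\,dx\,dy=\delta_{\ell m}.$$ The polynomials $\widetilde p_n,\widetilde q_n$ are $$\widetilde p_n(z)=\sum_{j=0}^n\frac{\Gamma(\alpha+n+j+1)(-z)^j}{j!\,(n-j)!\,\Gamma(\alpha+j+1)\Gamma(a+j+1)},\qquad \widetilde q_n(z)=\sum_{j=0}^n\frac{\Gamma(\alpha+n+j+1)(-z)^j}{j!\,(n-j)!\,\Gamma(\alpha+j+1)\Gamma(b+j+1)}.$$ *)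

theory Defs
  imports "HOL-Analysis.Analysis" "HOL-Computational_Algebra.Polynomial"
begin

text \<open>
  For \<open>a, b, a + b > -1\<close> the weighted kernel is absolutely integrable on the quadrant against every polynomial in
  \<open>x, y\<close>, so the iterated Lebesgue integral never takes the default value 0 of a
  non-integrable function.
\<close>

definition cauchy_laguerre_pairing :: "real \<Rightarrow> real \<Rightarrow> real poly \<Rightarrow> real poly \<Rightarrow> real" where
  "cauchy_laguerre_pairing a b f g =
     (LBINT y:{0<..}. (LBINT x:{0<..}.
        x powr a * y powr b * exp (- x - y) / (x + y) * poly f x * poly g y))"

definition cauchy_laguerre_biorthonormal ::
    "real \<Rightarrow> real \<Rightarrow> (nat \<Rightarrow> real poly) \<Rightarrow> (nat \<Rightarrow> real poly) \<Rightarrow> bool" where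
  "cauchy_laguerre_biorthonormal a b p q \<longleftrightarrow>
     (\<forall>n. degree (p n) = n \<and> degree (q n) = n \<and>
          lead_coeff (p n) = lead_coeff (q n) \<and> lead_coeff (p n) > 0) \<and>
     (\<forall>l m. cauchy_laguerre_pairing a b (p l) (q m) = (if l = m then 1 else 0))"

definition p_tilde :: "real \<Rightarrow> real \<Rightarrow> nat \<Rightarrow> real poly" where
  "p_tilde a b n = (\<Sum>j\<le>n. monom
     (Gamma (a + b + real n + real j + 1) * (-1) ^ j /
      (fact j * fact (n - j) * Gamma (a + b + real j + 1) * Gamma (a + real j + 1))) j)"

definition q_tilde :: "real \<Rightarrow> real \<Rightarrow> nat \<Rightarrow> real poly" where
  "q_tilde a b n = (\<Sum>j\<le>n. monom
     (Gamma (a + b + real n + real j + 1) * (-1) ^ j /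
      (fact j * fact (n - j) * Gamma (a + b + real j + 1) * Gamma (b + real j + 1))) j)"

definition pi_const :: "real \<Rightarrow> real \<Rightarrow> nat \<Rightarrow> real" where
  "pi_const a b n = sqrt (2 * real n + (a + b) + 1) *
     sqrt (Gamma (a + real n + 1) / Gamma (b + real n + 1))"

definition eta_const :: "real \<Rightarrow> real \<Rightarrow> nat \<Rightarrow> real" where
  "eta_const a b n = sqrt (2 * real n + (a + b) + 1) *
     sqrt (Gamma (b + real n + 1) / Gamma (a + real n + 1))"

end

theory Submission
  imports Defs
begin

text \<open>
  Writing \<open>exp (- x - y) / (x + y)\<close> as the integral of \<open>exp (- s * (x + y))\<close> over
  \<open>s \<ge> 1\<close> separates the variables, and Tonelli gives the bimoments of the weight in closed form:
  the pairing of \<open>x\<^sup>i\<close> with \<open>y\<^sup>j\<close> is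
  \<open>\<Gamma>(a+i+1) \<Gamma>(b+j+1) / (\<alpha>+i+j+1)\<close> with \<open>\<alpha> = a + b\<close>.
  The last factor is the integral of \<open>t\<^sup>\<alpha> t\<^sup>i t\<^sup>j\<close> over the unit interval. Hence the map
  that divides the coefficient of \<open>t\<^sup>i\<close> by \<open>\<Gamma>(a+i+1)\<close>, respectively by
  \<open>\<Gamma>(b+i+1)\<close>, turns the orthogonal polynomials for \<open>t\<^sup>\<alpha>\<close> on the unit interval, which
  are the Jacobi polynomials \<open>P\<^sub>n(1 - 2t)\<close> with parameters \<open>(\<alpha>, 0)\<close>, into a biorthogonal
  system. These images are \<open>p_tilde\<close> and \<open>q_tilde\<close>.

  Jacobi orthogonality is then an identity for finite sums. The pairing of \<open>t\<^sup>i\<close> with the \<open>n\<close>-th polynomial is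
  a sum over the poles of a partial fraction decomposition
  (\<open>alternating_binomial_sum_partial_fractions\<close>), whose closed form contains the Pochhammer symbol
  \<open>(-i)\<^sub>n\<close>; it vanishes for \<open>i < n\<close>. The case \<open>i = n\<close> gives the norm
  \<open>1 / (2n+\<alpha>+1)\<close>, which is the reciprocal of the product of \<open>pi_const\<close> and \<open>eta_const\<close>.
  The ratio of these two constants is the one that equalizes the leading coefficients.

  Conversely, any two biorthonormal systems agree up to a scalar in each degree, and the requirement
  of equal positive leading coefficients within each system forces the scalar to be \<open>1\<close>
  (\<open>biorthonormal_unique_left\<close>).

  Finally, integration against \<open>x\<^sup>a exp (- x)\<close> multiplies the coefficient of \<open>x\<^sup>j\<close> by
  \<open>\<Gamma>(a+j+1)\<close> and so undoes the division: the integral of \<open>p_tilde\<close> is the value of the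
  Jacobi polynomial at \<open>t = 1\<close>, which is \<open>(-1)\<^sup>n\<close>. Everything about \<open>q\<close> is obtained from
  \<open>p\<close> by exchanging \<open>a\<close> and \<open>b\<close>.
\<close>

section \<open>Finite differences and partial fractions\<close>

text \<open>
  Up to sign, the alternating binomial sum is an iterated forward difference at \<open>0\<close>; Pascal's rule
  peels off one difference, which is the induction step of the evaluations below.
\<close>
lemma alternating_binomial_sum_Suc:
  fixes g :: "nat \<Rightarrow> 'a::comm_ring_1"
  shows "(\<Sum>j\<le>Suc n. (-1) ^ j * of_nat (Suc n choose j) * g j) =
         (\<Sum>j\<le>n. (-1) ^ j * of_nat (n choose j) * (g j - g (Suc j)))"
proof -
  have "(\<Sum>j\<le>Suc n. (-1) ^ j * of_nat (Suc n choose j) * g j) =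
      g 0 + (\<Sum>j\<le>n. (-1) ^ Suc j * of_nat (n choose Suc j) * g (Suc j))
        + (\<Sum>j\<le>n. (-1) ^ Suc j * of_nat (n choose j) * g (Suc j))"
    by (subst sum.atMost_Suc_shift) (simp add: sum.distrib sum_subtractf sum_negf algebra_simps)
  also have "g 0 + (\<Sum>j\<le>n. (-1) ^ Suc j * of_nat (n choose Suc j) * g (Suc j)) =
      (\<Sum>j\<le>Suc n. (-1) ^ j * of_nat (n choose j) * g j)"
    by (subst sum.atMost_Suc_shift) simp
  also have "\<dots> = (\<Sum>j\<le>n. (-1) ^ j * of_nat (n choose j) * g j)"
    by (simp add: binomial_eq_0)
  finally show ?thesis
    by (simp add: sum_negf right_diff_distrib sum_subtractf)
qed

lemma pochhammer_forward_difference: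
  fixes c :: "'a::comm_ring_1"
  shows "pochhammer (c + 1) (Suc m) - pochhammer c (Suc m) = of_nat (Suc m) * pochhammer (c + 1) m"
  unfolding pochhammer_rec[of c] pochhammer_rec'[of "c + 1"] by (simp add: algebra_simps)

text \<open>
  The \<open>n\<close>-th forward difference kills polynomials of degree below \<open>n\<close> and sends a monic one of
  degree \<open>n\<close> to \<open>n!\<close>; the alternating sum differs from it by the factor \<open>(-1)\<^sup>n\<close>. For Pochhammer symbols each difference lowers the degree by one within the
  same family, which makes the induction close.
\<close>
lemma alternating_binomial_sum_pochhammer:
  fixes c :: "'a::field_char_0"
  assumes "m \<le> n"
  shows "(\<Sum>j\<le>n. (-1) ^ j * of_nat (n choose j) * pochhammer (c + of_nat j) m) =
         (if m = n then (-1) ^ n * fact n else 0)"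
  using assms
proof (induction n arbitrary: m c)
  case 0
  then show ?case by simp
next
  case (Suc n)
  show ?case
  proof (cases m)
    case 0
    then show ?thesis by (simp only: alternating_binomial_sum_Suc) simp
  next
    case (Suc k)
    have "pochhammer (c + of_nat j) m - pochhammer (c + of_nat (Suc j)) m =
        - of_nat m * pochhammer (c + 1 + of_nat j) k" for j
      using pochhammer_forward_difference[of "c + of_nat j" k] Suc by (simp add: algebra_simps)
    then have "(\<Sum>j\<le>Suc n. (-1) ^ j * of_nat (Suc n choose j) * pochhammer (c + of_nat j) m) =
        - of_nat m * (\<Sum>j\<le>n. (-1) ^ j * of_nat (n choose j) * pochhammer (c + 1 + of_nat j) k)"
      by (simp only: alternating_binomial_sum_Suc sum_distrib_left) (simp add: mult_ac)
    also have "\<dots> = - of_nat m * (if k = n then (-1) ^ n * fact n else 0)"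
      using Suc.IH[of k "c + 1"] Suc.prems Suc by simp
    finally show ?thesis using Suc by (auto simp: algebra_simps simp del: sum.atMost_Suc)
  qed
qed

lemma alternating_binomial_sum_inverse:
  fixes s :: "'a::field_char_0"
  assumes "pochhammer s (Suc n) \<noteq> 0"
  shows "(\<Sum>j\<le>n. (-1) ^ j * of_nat (n choose j) / (s + of_nat j)) = fact n / pochhammer s (Suc n)"
  using assms
proof (induction n arbitrary: s)
  case 0
  then show ?case by simp
next
  case (Suc n)
  have left: "pochhammer s (Suc (Suc n)) = s * pochhammer (s + 1) (Suc n)"
    by (rule pochhammer_rec)
  have right: "pochhammer s (Suc (Suc n)) = pochhammer s (Suc n) * (s + of_nat (Suc n))"
    by (rule pochhammer_Suc)
  have nz: "s \<noteq> 0" "pochhammer (s + 1) (Suc n) \<noteq> 0"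
      "pochhammer s (Suc n) \<noteq> 0" "s + of_nat (Suc n) \<noteq> 0"
    using Suc.prems left right by auto
  have "(\<Sum>j\<le>Suc n. (-1) ^ j * of_nat (Suc n choose j) / (s + of_nat j)) =
      (\<Sum>j\<le>n. (-1) ^ j * of_nat (n choose j) / (s + of_nat j))
      - (\<Sum>j\<le>n. (-1) ^ j * of_nat (n choose j) / (s + 1 + of_nat j))"
    using alternating_binomial_sum_Suc[of n "\<lambda>j. 1 / (s + of_nat j)"]
    by (simp add: right_diff_distrib sum_subtractf add_ac)
  also have "\<dots> = fact n / pochhammer s (Suc n) - fact n / pochhammer (s + 1) (Suc n)"
    using Suc.IH nz by simp
  also have "fact n / pochhammer s (Suc n) = fact n * (s + of_nat (Suc n)) / pochhammer s (Suc (Suc n))"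
    using nz by (subst right) simp
  also have "fact n / pochhammer (s + 1) (Suc n) = fact n * s / pochhammer s (Suc (Suc n))"
    using nz by (subst left) simp
  finally show ?case
    by (simp add: diff_divide_distrib[symmetric] algebra_simps)
qed

text \<open>
  This is the partial fraction expansion, in the variable \<open>s\<close>, of a rational function with simple
  poles at \<open>0, -1, \<dots>, -n\<close>. The induction on \<open>m\<close> splits off one Pochhammer factor as
  \<open>c + j + m = (s + j) + (c - s + m)\<close>: the first part cancels the denominator and leaves an
  \<open>n\<close>-th difference of a polynomial of degree below \<open>n\<close>, which is zero.
\<close>
lemma alternating_binomial_sum_partial_fractions:
  fixes s c :: "'a::field_char_0"
  assumes "m \<le> n" and "pochhammer s (Suc n) \<noteq> 0"
  shows "(\<Sum>j\<le>n. (-1) ^ j * of_nat (n choose j) * pochhammer (c + of_nat j) m / (s + of_nat j)) =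
         fact n * pochhammer (c - s) m / pochhammer s (Suc n)"
  using assms(1)
proof (induction m)
  case 0
  then show ?case using alternating_binomial_sum_inverse[OF assms(2)] by simp
next
  case (Suc m)
  have nz: "s + of_nat j \<noteq> 0" if "j \<le> n" for j
    using assms(2) that by (auto simp: pochhammer_eq_0_iff add_eq_0_iff2 less_Suc_eq_le)
  have "pochhammer (c + of_nat j) (Suc m) / (s + of_nat j) = pochhammer (c + of_nat j) m
      + (c - s + of_nat m) * (pochhammer (c + of_nat j) m / (s + of_nat j))" if "j \<le> n" for j
    using nz[OF that] by (simp add: pochhammer_Suc field_simps)
  then have "(\<Sum>j\<le>n. (-1) ^ j * of_nat (n choose j) * pochhammer (c + of_nat j) (Suc m) / (s + of_nat j)) =
      (\<Sum>j\<le>n. (-1) ^ j * of_nat (n choose j) * (pochhammer (c + of_nat j) m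
      + (c - s + of_nat m) * (pochhammer (c + of_nat j) m / (s + of_nat j))))"
    by (intro sum.cong) (simp_all flip: times_divide_eq_right)
  also have "\<dots> = (\<Sum>j\<le>n. (-1) ^ j * of_nat (n choose j) * pochhammer (c + of_nat j) m)
      + (c - s + of_nat m) *
        (\<Sum>j\<le>n. (-1) ^ j * of_nat (n choose j) * pochhammer (c + of_nat j) m / (s + of_nat j))"
    by (simp add: distrib_left sum.distrib sum_distrib_left mult_ac)
  also have "\<dots> = fact n * pochhammer (c - s) (Suc m) / pochhammer s (Suc n)"
    using Suc alternating_binomial_sum_pochhammer[of m n c] by (simp add: pochhammer_rec' mult_ac)
  finally show ?case .
qed

section \<open>Jacobi coefficients\<close>

lemma Gamma_shift_pos:
  fixes c :: real
  assumes "c > -1"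
  shows "Gamma (c + real j + 1) > 0"
  by (rule Gamma_real_pos) (use assms in simp)

text \<open>
  The coefficient of \<open>t\<^sup>j\<close> in the Jacobi polynomial \<open>P\<^sub>n(1 - 2t)\<close> with parameters
  \<open>(\<alpha>, 0)\<close>. Binomial and Pochhammer factors are used instead of factorials and Gamma quotients
  so that the value is \<open>0\<close> for \<open>j > n\<close> and the finite difference identities apply directly.
\<close>
definition jacobi_coeff :: "real \<Rightarrow> nat \<Rightarrow> nat \<Rightarrow> real" where
  "jacobi_coeff \<alpha> n j =
     (-1) ^ j * real (n choose j) * pochhammer (\<alpha> + 1 + real j) n / fact n"

lemma sum_jacobi_coeff: "(\<Sum>j\<le>n. jacobi_coeff \<alpha> n j) = (-1) ^ n"
  using alternating_binomial_sum_pochhammer[of n n "\<alpha> + 1"]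
  by (simp add: jacobi_coeff_def flip: sum_divide_distrib)

text \<open>
  Up to its integral form this is Jacobi orthogonality: \<open>1 / (\<alpha>+i+j+1)\<close> is the integral of
  \<open>t\<^sup>\<alpha> t\<^sup>i t\<^sup>j\<close> over the unit interval, and the right-hand side vanishes for \<open>i < n\<close>.
\<close>
lemma jacobi_coeff_moment:
  assumes "\<alpha> > -1"
  shows "(\<Sum>j\<le>n. jacobi_coeff \<alpha> n j / (\<alpha> + real i + real j + 1)) =
         pochhammer (- real i) n / pochhammer (\<alpha> + 1 + real i) (Suc n)"
proof -
  have "pochhammer (\<alpha> + 1 + real i) (Suc n) \<noteq> 0"
    using pochhammer_pos[of "\<alpha> + 1 + real i" "Suc n"] assms by simp
  from alternating_binomial_sum_partial_fractions[OF order.refl this, of "\<alpha> + 1"]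
  have "(\<Sum>j\<le>n. (-1) ^ j * real (n choose j) * pochhammer (\<alpha> + 1 + real j) n / (\<alpha> + 1 + real i + real j))
      = fact n * pochhammer (- real i) n / pochhammer (\<alpha> + 1 + real i) (Suc n)" by simp
  moreover have "(\<Sum>j\<le>n. jacobi_coeff \<alpha> n j / (\<alpha> + real i + real j + 1)) =
     (\<Sum>j\<le>n. (-1) ^ j * real (n choose j) * pochhammer (\<alpha> + 1 + real j) n / (\<alpha> + 1 + real i + real j)) / fact n"
    by (simp add: jacobi_coeff_def sum_divide_distrib add_ac mult_ac)
  ultimately show ?thesis by simp
qed

lemma jacobi_coeff_eq_Gamma:
  assumes "\<alpha> > -1" and "j \<le> n"
  shows "jacobi_coeff \<alpha> n j = Gamma (\<alpha> + real n + real j + 1) * (-1) ^ j /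
           (fact j * fact (n - j) * Gamma (\<alpha> + real j + 1))"
proof -
  have "\<alpha> + 1 + real j \<notin> \<int>\<^sub>\<le>\<^sub>0"
    using assms(1) by (auto elim!: nonpos_Ints_cases')
  from pochhammer_Gamma[OF this, of n]
  have "pochhammer (\<alpha> + 1 + real j) n = Gamma (\<alpha> + real n + real j + 1) / Gamma (\<alpha> + real j + 1)"
    by (simp add: add_ac)
  then show ?thesis
    using assms(2) by (simp add: jacobi_coeff_def binomial_fact mult_ac)
qed

lemma coeff_p_tilde:
  assumes "a + b > -1"
  shows "coeff (p_tilde a b n) j = jacobi_coeff (a + b) n j / Gamma (a + real j + 1)"
proof -
  have "coeff (p_tilde a b n) j = (if j \<le> n then Gamma (a + b + real n + real j + 1) * (-1) ^ j /
      (fact j * fact (n - j) * Gamma (a + b + real j + 1) * Gamma (a + real j + 1)) else 0)"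
    by (simp add: p_tilde_def coeff_sum coeff_monom)
  also have "\<dots> = jacobi_coeff (a + b) n j / Gamma (a + real j + 1)"
  proof (cases "j \<le> n")
    case True
    then show ?thesis using jacobi_coeff_eq_Gamma[OF assms True] by simp
  qed (simp add: jacobi_coeff_def binomial_eq_0)
  finally show ?thesis .
qed

lemma q_tilde_conv_p_tilde: "q_tilde a b = p_tilde b a"
  by (simp add: q_tilde_def p_tilde_def fun_eq_iff add.commute)

lemma eta_const_conv_pi_const: "eta_const a b = pi_const b a"
  by (simp add: eta_const_def pi_const_def fun_eq_iff add.commute)

lemma degree_p_tilde_le: "degree (p_tilde a b n) \<le> n"
  unfolding p_tilde_def by (rule degree_sum_le) (auto intro: order.trans[OF degree_monom_le])

section \<open>Bimoments of the Cauchy-Laguerre weight\<close>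

lemma nn_integral_powr_exp:
  fixes c s :: real
  assumes "c > -1" and "s > 0"
  shows "(\<integral>\<^sup>+x. ennreal (indicator {0<..} x * x powr c * exp (- s * x)) \<partial>lborel) =
         ennreal (Gamma (c + 1) * s powr (- c - 1))"
proof -
  define f where "f x = ennreal (indicator {0<..} x * x powr c * exp (- s * x))" for x :: real
  have [measurable]: "f \<in> borel_measurable borel"
    unfolding f_def by measurable
  have "(\<integral>\<^sup>+x. f x \<partial>lborel) = ennreal (1 / s) * (\<integral>\<^sup>+x. f ((1 / s) * x) \<partial>lborel)"
    using nn_integral_real_affine[of f "1 / s" 0] assms(2) by simp
  also have "(\<integral>\<^sup>+x. f ((1 / s) * x) \<partial>lborel) =
      (\<integral>\<^sup>+x. ennreal (s powr (- c)) * ennreal (indicator {0..} x * x powr c / exp x) \<partial>lborel)"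
  proof (rule nn_integral_cong)
    fix x :: real
    have "indicator {0<..} (x / s) * (x / s) powr c * exp (- x) =
        s powr (- c) * (indicator {0..} x * x powr c / exp x)"
      using assms(2)
      by (cases "x > 0") (auto simp: indicator_def powr_divide powr_minus exp_minus field_simps)
    then show "f ((1 / s) * x) = ennreal (s powr (- c)) * ennreal (indicator {0..} x * x powr c / exp x)"
      using assms(2) by (simp add: f_def flip: ennreal_mult')
  qed
  also have "\<dots> = ennreal (s powr (- c)) * ennreal (Gamma (c + 1))"
    using Gamma_conv_nn_integral_real[of "c + 1"] assms(1) by (simp add: nn_integral_cmult)
  also have "ennreal (1 / s) * (ennreal (s powr (- c)) * ennreal (Gamma (c + 1))) =
      ennreal (Gamma (c + 1) * s powr (- c - 1))"
    using assms by (simp add: powr_diff mult_ac flip: ennreal_mult')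
  finally show ?thesis by (simp add: f_def)
qed

lemma nn_integral_powr_to_inf:
  fixes e :: real
  assumes "e < -1"
  shows "(\<integral>\<^sup>+s. ennreal (indicator {1..} s * s powr e) \<partial>lborel) = ennreal (- 1 / (e + 1))"
  using nn_integral_has_integral_lebesgue[OF _ has_integral_powr_to_inf[OF assms, of 1]] by simp

lemma nn_integral_exp_to_inf:
  fixes u :: real
  assumes "u > 0"
  shows "(\<integral>\<^sup>+s. ennreal (indicator {1..} s * exp (- s * u)) \<partial>lborel) = ennreal (exp (- u) / u)"
  using nn_integral_has_integral_lebesgue[OF _ has_integral_exp_minus_to_infinity[OF assms, of 1]]
  by (simp add: mult.commute)

text \<open>
  The indicators are part of the kernel so that its iterated integrals over the half-lines become one
  integral with respect to a product measure.
\<close>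
definition cauchy_laguerre_kernel :: "real \<Rightarrow> real \<Rightarrow> real \<Rightarrow> real \<Rightarrow> real" where
  "cauchy_laguerre_kernel a b x y =
     indicator {0<..} x * indicator {0<..} y *
       (x powr a * y powr b * exp (- x - y) / (x + y))"

lemma cauchy_laguerre_kernel_measurable [measurable]:
  "case_prod (cauchy_laguerre_kernel a b) \<in> borel_measurable (lborel \<Otimes>\<^sub>M lborel)"
  unfolding cauchy_laguerre_kernel_def by measurable

lemma cauchy_laguerre_kernel_nonneg: "0 \<le> cauchy_laguerre_kernel a b x y"
  by (auto simp: cauchy_laguerre_kernel_def indicator_def)

text \<open>
  After \<open>exp (- x - y) / (x + y)\<close> is written as an integral over \<open>s \<ge> 1\<close>, the integrals over
  \<open>x\<close> and \<open>y\<close> separate into scaled Gamma integrals \<open>\<Gamma>(a+1) s\<^sup>-\<^sup>a\<^sup>-\<^sup>1\<close> and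
  \<open>\<Gamma>(b+1) s\<^sup>-\<^sup>b\<^sup>-\<^sup>1\<close>; the remaining power of \<open>s\<close> is integrable at infinity exactly
  because \<open>a + b > -1\<close>. All integrands are nonnegative, so finiteness of the result also proves
  integrability.
\<close>
lemma has_bochner_integral_cauchy_laguerre_kernel:
  assumes "a > -1" and "b > -1" and "a + b > -1"
  shows "has_bochner_integral (lborel \<Otimes>\<^sub>M lborel) (case_prod (cauchy_laguerre_kernel a b))
           (Gamma (a + 1) * Gamma (b + 1) / (a + b + 1))"
proof -
  \<comment> \<open>The kernel is the integral over \<open>s\<close> of \<open>J s * L a s x * L b s y\<close>.\<close>
  define L where "L c s x = indicator {0<..} x * x powr c * exp (- s * x)" for c s x :: real
  define J where "J s = (indicator {1..} s :: real)" for s :: real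
  have [measurable]: "J \<in> borel_measurable borel"
    by (simp add: J_def[abs_def])
  have [measurable]: "case_prod (L c) \<in> borel_measurable (lborel \<Otimes>\<^sub>M lborel)" for c
    unfolding L_def by measurable
  have [measurable]: "L c s \<in> borel_measurable borel" for c s
    unfolding L_def by measurable
  have nonneg: "0 \<le> L c s x" "0 \<le> J s" for c s x
    by (auto simp: L_def J_def)
  have kernel: "ennreal (cauchy_laguerre_kernel a b x y) =
      (\<integral>\<^sup>+s. ennreal (J s * L a s x * L b s y) \<partial>lborel)" for x y
  proof (cases "x > 0 \<and> y > 0")
    case True
    have "(\<integral>\<^sup>+s. ennreal (J s * L a s x * L b s y) \<partial>lborel) =
        (\<integral>\<^sup>+s. ennreal (x powr a * y powr b) * ennreal (J s * exp (- s * (x + y))) \<partial>lborel)"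
      using True
      by (intro nn_integral_cong)
         (simp add: L_def nonneg exp_add[symmetric] algebra_simps flip: ennreal_mult')
    also have "\<dots> = ennreal (x powr a * y powr b) * ennreal (exp (- (x + y)) / (x + y))"
      using True nn_integral_exp_to_inf[of "x + y"] by (simp add: nn_integral_cmult J_def)
    also have "\<dots> = ennreal (cauchy_laguerre_kernel a b x y)"
      using True by (simp add: cauchy_laguerre_kernel_def flip: ennreal_mult')
    finally show ?thesis by simp
  next
    case False
    then have "cauchy_laguerre_kernel a b x y = 0" "\<And>s. J s * L a s x * L b s y = 0"
      by (auto simp: L_def cauchy_laguerre_kernel_def)
    then show ?thesis by (simp only:) simp
  qed
  have "(\<integral>\<^sup>+z. ennreal (case_prod (cauchy_laguerre_kernel a b) z) \<partial>(lborel \<Otimes>\<^sub>M lborel)) =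
      (\<integral>\<^sup>+x. \<integral>\<^sup>+y. ennreal (cauchy_laguerre_kernel a b x y) \<partial>lborel \<partial>lborel)"
    by (subst lborel.nn_integral_fst[symmetric]) simp_all
  also have "\<dots> = (\<integral>\<^sup>+x. \<integral>\<^sup>+s. \<integral>\<^sup>+y. ennreal (J s * L a s x * L b s y) \<partial>lborel \<partial>lborel \<partial>lborel)"
    unfolding kernel by (intro nn_integral_cong lborel_pair.Fubini') measurable
  also have "\<dots> = (\<integral>\<^sup>+s. \<integral>\<^sup>+x. \<integral>\<^sup>+y. ennreal (J s * L a s x * L b s y) \<partial>lborel \<partial>lborel \<partial>lborel)"
    by (intro lborel_pair.Fubini') measurable
  also have "\<dots> = (\<integral>\<^sup>+s. ennreal (Gamma (a + 1) * Gamma (b + 1)) *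
      ennreal (indicator {1..} s * s powr (- a - b - 2)) \<partial>lborel)"
  proof (rule nn_integral_cong)
    fix s :: real
    have L_int: "(\<integral>\<^sup>+x. ennreal (L c s x) \<partial>lborel) = ennreal (Gamma (c + 1) * s powr (- c - 1))"
      if "c > -1" "s \<ge> 1" for c
      using nn_integral_powr_exp[of c s] that by (simp add: L_def)
    have "(\<integral>\<^sup>+x. \<integral>\<^sup>+y. ennreal (J s * L a s x * L b s y) \<partial>lborel \<partial>lborel) =
        ennreal (J s) * (\<integral>\<^sup>+x. ennreal (L a s x) \<partial>lborel) * (\<integral>\<^sup>+y. ennreal (L b s y) \<partial>lborel)"
      by (simp add: ennreal_mult nonneg nn_integral_cmult nn_integral_multc)
    also have "\<dots> = ennreal (Gamma (a + 1) * Gamma (b + 1)) *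
        ennreal (indicator {1..} s * s powr (- a - b - 2))"
    proof (cases "s \<ge> 1")
      case True
      have "s powr (- a - b - 2) = s powr (- a - 1) * s powr (- b - 1)"
        by (simp flip: powr_add)
      then show ?thesis
        using True assms by (simp add: L_int J_def mult_ac less_imp_le flip: ennreal_mult)
    qed (simp add: J_def)
    finally show "(\<integral>\<^sup>+x. \<integral>\<^sup>+y. ennreal (J s * L a s x * L b s y) \<partial>lborel \<partial>lborel) =
        ennreal (Gamma (a + 1) * Gamma (b + 1)) * ennreal (indicator {1..} s * s powr (- a - b - 2))" .
  qed
  also have "\<dots> = ennreal (Gamma (a + 1) * Gamma (b + 1)) * ennreal (1 / (a + b + 1))"
  proof -
    have "- 1 / (- a - b - 2 + 1) = 1 / (a + b + 1)"
      using assms(3) by (simp add: divide_simps)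
    then show ?thesis
      using assms nn_integral_powr_to_inf[of "- a - b - 2"] by (simp add: nn_integral_cmult)
  qed
  also have "\<dots> = ennreal (Gamma (a + 1) * Gamma (b + 1) / (a + b + 1))"
    using assms by (simp add: less_imp_le flip: ennreal_mult)
  finally show ?thesis
    using assms cauchy_laguerre_kernel_nonneg
    by (intro has_bochner_integral_nn_integral) (auto simp: less_imp_le)
qed

text \<open>
  The bounds \<open>M\<close> and \<open>N\<close> may exceed the degrees, so that polynomials of different degrees can be
  brought to a common range of summation.
\<close>
lemma cauchy_laguerre_pairing_eq_moment_sum:
  assumes "a > -1" and "b > -1" and "a + b > -1"
  assumes "degree f \<le> M" and "degree g \<le> N"
  shows "cauchy_laguerre_pairing a b f g =
    (\<Sum>i\<le>M. \<Sum>j\<le>N. coeff f i * coeff g j *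
        (Gamma (a + real i + 1) * Gamma (b + real j + 1) / (a + b + real i + real j + 1)))"
    (is "_ = ?S")
proof -
  define F where "F x y = (\<Sum>i\<le>M. \<Sum>j\<le>N.
      coeff f i * coeff g j * cauchy_laguerre_kernel (a + real i) (b + real j) x y)" for x y
  have "has_bochner_integral (lborel \<Otimes>\<^sub>M lborel) (case_prod F) ?S"
  proof -
    have "has_bochner_integral (lborel \<Otimes>\<^sub>M lborel)
        (\<lambda>z. coeff f i * coeff g j * case_prod (cauchy_laguerre_kernel (a + real i) (b + real j)) z)
        (coeff f i * coeff g j *
          (Gamma (a + real i + 1) * Gamma (b + real j + 1) / (a + b + real i + real j + 1)))" for i j
      using has_bochner_integral_cauchy_laguerre_kernel[of "a + real i" "b + real j"] assms
      by (intro has_bochner_integral_mult_right) (simp add: algebra_simps)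
    then show ?thesis
      unfolding F_def by (simp add: case_prod_unfold has_bochner_integral_sum)
  qed
  then have "integrable (lborel \<Otimes>\<^sub>M lborel) (case_prod F)" and
    integral: "integral\<^sup>L (lborel \<Otimes>\<^sub>M lborel) (case_prod F) = ?S"
    by (simp_all add: has_bochner_integral_iff)
  then have iterated: "(LINT y|lborel. LINT x|lborel. F x y) = ?S"
    using lborel_pair.integral_snd[of F] by simp
  have F_eq: "F x y = indicator {0<..} y * (indicator {0<..} x *
      (x powr a * y powr b * exp (- x - y) / (x + y) * poly f x * poly g y))" for x y
  proof (cases "x > 0 \<and> y > 0")
    case True
    have "poly f x = (\<Sum>i\<le>M. coeff f i * x ^ i)" and "poly g y = (\<Sum>j\<le>N. coeff g j * y ^ j)"
      using assms(4,5) by (auto simp: poly_altdef intro!: sum.mono_neutral_left le_degree)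
    then have poly: "poly f x * poly g y = (\<Sum>i\<le>M. \<Sum>j\<le>N. coeff f i * coeff g j * (x ^ i * y ^ j))"
      by (simp add: sum_product mult_ac)
    have "F x y = (x powr a * y powr b * exp (- x - y) / (x + y)) *
        (\<Sum>i\<le>M. \<Sum>j\<le>N. coeff f i * coeff g j * (x ^ i * y ^ j))"
      using True by (simp add: F_def cauchy_laguerre_kernel_def powr_add powr_realpow
          sum_distrib_left mult_ac)
    then show ?thesis
      using True unfolding poly[symmetric] by (simp add: mult.assoc)
  qed (auto simp: F_def cauchy_laguerre_kernel_def)
  show ?thesis
    using iterated
    by (simp only: cauchy_laguerre_pairing_def set_lebesgue_integral_def F_eq real_scaleR_def
        integral_mult_right_zero)
qed

lemma integral_laguerre_weight_poly:
  fixes a :: real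
  assumes "a > -1" and "degree f \<le> N"
  shows "(LBINT x:{0<..}. x powr a * exp (- x) * poly f x) =
         (\<Sum>j\<le>N. coeff f j * Gamma (a + real j + 1))"
proof -
  have moment: "has_bochner_integral lborel (\<lambda>x. indicator {0<..} x * x powr (a + real j) * exp (- x))
      (Gamma (a + real j + 1))" for j
    using nn_integral_powr_exp[of "a + real j" 1] assms(1)
    by (intro has_bochner_integral_nn_integral) (auto simp: less_imp_le)
  have "has_bochner_integral lborel
      (\<lambda>x. \<Sum>j\<le>N. coeff f j * (indicator {0<..} x * x powr (a + real j) * exp (- x)))
      (\<Sum>j\<le>N. coeff f j * Gamma (a + real j + 1))"
    by (intro has_bochner_integral_sum has_bochner_integral_mult_right) (use moment in auto)
  moreover have "(\<Sum>j\<le>N. coeff f j * (indicator {0<..} x * x powr (a + real j) * exp (- x))) =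
      indicator {0<..} x *\<^sub>R (x powr a * exp (- x) * poly f x)" for x
  proof (cases "x > 0")
    case True
    have "poly f x = (\<Sum>j\<le>N. coeff f j * x ^ j)"
      using assms(2) by (auto simp: poly_altdef intro!: sum.mono_neutral_left le_degree)
    with True show ?thesis
      by (simp add: powr_add powr_realpow sum_distrib_left mult_ac)
  qed auto
  ultimately show ?thesis
    by (simp add: set_lebesgue_integral_def has_bochner_integral_iff)
qed

lemma cauchy_laguerre_pairing_commute:
  assumes "a > -1" and "b > -1" and "a + b > -1"
  shows "cauchy_laguerre_pairing a b f g = cauchy_laguerre_pairing b a g f"
proof -
  have "b + a > -1" using assms(3) by simp
  show ?thesis
    unfolding cauchy_laguerre_pairing_eq_moment_sum[OF assms order.refl order.refl]
      cauchy_laguerre_pairing_eq_moment_sum[OF assms(2,1) \<open>b + a > -1\<close> order.refl order.refl]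
    by (subst sum.swap) (simp add: ac_simps)
qed

lemma cauchy_laguerre_pairing_diff_smult_left:
  assumes "a > -1" and "b > -1" and "a + b > -1"
  shows "cauchy_laguerre_pairing a b (f - smult c f') g =
         cauchy_laguerre_pairing a b f g - c * cauchy_laguerre_pairing a b f' g"
proof -
  define M where "M = max (degree f) (degree f')"
  have deg: "degree f \<le> M" "degree f' \<le> M" "degree (f - smult c f') \<le> M"
    by (auto simp: M_def intro!: degree_diff_le order.trans[OF degree_smult_le])
  show ?thesis
    by (simp add: cauchy_laguerre_pairing_eq_moment_sum[OF assms deg(1) order.refl]
        cauchy_laguerre_pairing_eq_moment_sum[OF assms deg(2) order.refl]
        cauchy_laguerre_pairing_eq_moment_sum[OF assms deg(3) order.refl]
        left_diff_distrib diff_divide_distrib sum_subtractf sum_distrib_left mult.assoc)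
qed

lemma cauchy_laguerre_pairing_zero_left:
  assumes "a > -1" and "b > -1" and "a + b > -1"
  shows "cauchy_laguerre_pairing a b 0 g = 0"
  using cauchy_laguerre_pairing_eq_moment_sum[OF assms _ order.refl, of 0 0 g] by simp

lemma cauchy_laguerre_pairing_smult:
  assumes "a > -1" and "b > -1" and "a + b > -1"
  shows "cauchy_laguerre_pairing a b (smult c f) (smult d g) =
         c * d * cauchy_laguerre_pairing a b f g"
  by (simp add: cauchy_laguerre_pairing_eq_moment_sum[OF assms degree_smult_le degree_smult_le]
      cauchy_laguerre_pairing_eq_moment_sum[OF assms order.refl order.refl] sum_distrib_left mult_ac)

section \<open>Uniqueness of biorthonormal systems\<close>

lemma degree_diff_smult_lead_less:
  fixes f g :: "'a::field poly"
  assumes "degree f \<le> n" and "degree g = n" and "g \<noteq> 0"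
  shows "f - smult (coeff f n / lead_coeff g) g = 0 \<or>
         degree (f - smult (coeff f n / lead_coeff g) g) < n"
proof -
  let ?r = "f - smult (coeff f n / lead_coeff g) g"
  have "degree ?r \<le> n"
    using assms by (auto intro!: degree_diff_le order.trans[OF degree_smult_le])
  moreover have "coeff g n \<noteq> 0"
    using assms(2,3) leading_coeff_neq_0 by blast
  then have "coeff ?r n = 0"
    using assms(2) by simp
  ultimately show ?thesis
    by (metis le_neq_implies_less leading_coeff_0_iff)
qed

lemma biorthonormalD:
  assumes "cauchy_laguerre_biorthonormal a b p q"
  shows "degree (p n) = n" and "degree (q n) = n"
    and "lead_coeff (p n) = lead_coeff (q n)" and "lead_coeff (p n) > 0"
    and "cauchy_laguerre_pairing a b (p n) (q m) = (if n = m then 1 else 0)"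
  using assms unfolding cauchy_laguerre_biorthonormal_def by blast+

lemma biorthonormal_swap:
  assumes "a > -1" and "b > -1" and "a + b > -1"
    and "cauchy_laguerre_biorthonormal a b p q"
  shows "cauchy_laguerre_biorthonormal b a q p"
  using assms(4)
  unfolding cauchy_laguerre_biorthonormal_def cauchy_laguerre_pairing_commute[OF assms(1-3)]
  by metis

text \<open>
  Since the degrees of the \<open>p k\<close> are exact, a polynomial of degree below \<open>n\<close> is a combination of
  \<open>p 0, \<dots>, p (n - 1)\<close> and hence orthogonal to \<open>q n\<close>. For degree at most \<open>n\<close> only the
  component along \<open>p n\<close> survives, and it is read off from the coefficient of \<open>x\<^sup>n\<close>.
\<close>
lemma biorthonormal_pairing_left:
  assumes ab: "a > -1" "b > -1" "a + b > -1"
    and bi: "cauchy_laguerre_biorthonormal a b p q"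
    and "degree f \<le> n"
  shows "cauchy_laguerre_pairing a b f (q n) = coeff f n / lead_coeff (p n)"
proof -
  note deg = biorthonormalD(1)[OF bi] and pair = biorthonormalD(5)[OF bi]
  have nz: "p k \<noteq> 0" for k
    using biorthonormalD(4)[OF bi, of k] by auto
  have step: "cauchy_laguerre_pairing a b g (q n) =
      cauchy_laguerre_pairing a b (g - smult c (p k)) (q n) + (if k = n then c else 0)" for g c k
    by (simp add: cauchy_laguerre_pairing_diff_smult_left[OF ab] pair)
  have lower: "g = 0 \<or> degree g < n \<Longrightarrow> cauchy_laguerre_pairing a b g (q n) = 0" for g
  proof (induction "degree g" arbitrary: g rule: less_induct)
    case less
    show ?case
    proof (cases "g = 0")
      case False
      let ?r = "g - smult (coeff g (degree g) / lead_coeff (p (degree g))) (p (degree g))"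
      have "?r = 0 \<or> degree ?r < degree g"
        by (rule degree_diff_smult_lead_less) (simp_all add: deg nz)
      then have "cauchy_laguerre_pairing a b ?r (q n) = 0"
        using less False cauchy_laguerre_pairing_zero_left[OF ab] by auto
      then show ?thesis
        using less.prems False step[of g "coeff g (degree g) / lead_coeff (p (degree g))" "degree g"]
        by auto
    qed (simp add: cauchy_laguerre_pairing_zero_left[OF ab])
  qed
  show ?thesis
    using lower[OF degree_diff_smult_lead_less[OF assms(5) deg nz]]
      step[of f "coeff f n / lead_coeff (p n)" n] by simp
qed

text \<open>
  Both \<open>p n\<close> and \<open>p' n\<close> are orthogonal to all polynomials of degree below \<open>n\<close>, so they are
  proportional. If \<open>p n = \<kappa> p' n\<close>, then the normalization of the pairing gives
  \<open>q' n\<close> the leading coefficient of \<open>\<kappa> q n\<close>; equal leading coefficients within each pair then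
  yield \<open>\<kappa>\<^sup>2 = 1\<close>, and positivity excludes \<open>\<kappa> = -1\<close>.
\<close>
lemma biorthonormal_unique_left:
  assumes ab: "a > -1" "b > -1" "a + b > -1"
    and bi: "cauchy_laguerre_biorthonormal a b p q"
    and bi': "cauchy_laguerre_biorthonormal a b p' q'"
  shows "p n = p' n"
proof -
  note deg = biorthonormalD(1)[OF bi] biorthonormalD(1,2)[OF bi']
  note lead = biorthonormalD(3,4)[OF bi, of n] biorthonormalD(3,4)[OF bi', of n]
  note pair' = biorthonormalD(5)[OF bi']
  have nz: "lead_coeff (p' m) \<noteq> 0" for m
    using biorthonormalD(4)[OF bi', of m] by (rule less_imp_neq[THEN not_sym])
  have "b + a > -1" using ab by simp
  \<comment> \<open>The scalar for which \<open>p n\<close> and \<open>\<kappa> * p' n\<close> have the same pairing with \<open>q' n\<close>.\<close>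
  define \<kappa> where "\<kappa> = lead_coeff (q' n) / lead_coeff (q n)"
  define r where "r = p n - smult \<kappa> (p' n)"
  have "cauchy_laguerre_pairing a b (p n) (q' m) = \<kappa> * (if n = m then 1 else 0)" if "m \<le> n" for m
  proof -
    have "cauchy_laguerre_pairing a b (p n) (q' m) = coeff (q' m) n / lead_coeff (q n)"
      unfolding cauchy_laguerre_pairing_commute[OF ab]
      by (rule biorthonormal_pairing_left[OF ab(2,1) \<open>b + a > -1\<close> biorthonormal_swap[OF ab bi]])
         (simp add: deg that)
    then show ?thesis
      using that by (auto simp: \<kappa>_def deg coeff_eq_0)
  qed
  then have orth: "cauchy_laguerre_pairing a b r (q' m) = 0" if "m \<le> n" for m
    using that by (simp add: r_def cauchy_laguerre_pairing_diff_smult_left[OF ab] pair')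
  have "degree r \<le> n"
    unfolding r_def by (intro degree_diff_le order.trans[OF degree_smult_le]) (simp_all add: deg)
  \<comment> \<open>Pairing \<open>r\<close> with the \<open>q'\<close> of its own degree detects its leading coefficient.\<close>
  then have "lead_coeff r / lead_coeff (p' (degree r)) = 0"
    using biorthonormal_pairing_left[OF ab bi', of r "degree r"] orth[of "degree r"] by simp
  then have "r = 0"
    using nz by simp
  then have eq: "p n = smult \<kappa> (p' n)"
    by (simp add: r_def)
  \<comment> \<open>The common leading coefficients of the two pairs are each \<open>\<kappa>\<close> times the other.\<close>
  then have "lead_coeff (p n) = \<kappa> * lead_coeff (p' n)"
    by (metis lead_coeff_smult)
  also have "lead_coeff (p' n) = \<kappa> * lead_coeff (p n)"
  proof -
    have "lead_coeff (q n) \<noteq> 0" using lead by linarith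
    then have "\<kappa> * lead_coeff (q n) = lead_coeff (q' n)"
      by (metis \<kappa>_def nonzero_divide_eq_eq)
    then show ?thesis using lead by simp
  qed
  finally have "\<kappa>\<^sup>2 = 1"
    using lead by (auto simp: power2_eq_square)
  moreover have "\<kappa> > 0"
    using lead by (simp add: \<kappa>_def)
  ultimately have "\<kappa> = 1"
    by (simp add: power2_eq_1_iff)
  with eq show ?thesis by simp
qed

section \<open>The explicit biorthonormal system\<close>

text \<open>
  The Gamma factors of the bimoments cancel the denominators \<open>\<Gamma>(b+j+1)\<close> in \<open>q_tilde\<close>, which
  leaves the Jacobi moments; of these only the one with \<open>i = m\<close> is nonzero.
\<close>
lemma pairing_q_tilde:
  assumes "a > -1" and "b > -1" and "a + b > -1"
  assumes "degree f \<le> m"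
  shows "cauchy_laguerre_pairing a b f (q_tilde a b m) =
         coeff f m * Gamma (a + real m + 1) * (-1) ^ m * fact m /
           pochhammer (a + b + 1 + real m) (Suc m)"
proof -
  have Gamma_nz: "Gamma (b + real j + 1) \<noteq> 0" for j
    using Gamma_shift_pos[OF assms(2), of j] by simp
  have ba: "b + a > -1" "b + a = a + b" using assms(3) by simp_all
  have coeff_q: "coeff (q_tilde a b m) j = jacobi_coeff (a + b) m j / Gamma (b + real j + 1)" for j
    using coeff_p_tilde[OF ba(1)] by (simp add: q_tilde_conv_p_tilde ba(2))
  have deg_q: "degree (q_tilde a b m) \<le> m"
    by (simp add: q_tilde_conv_p_tilde degree_p_tilde_le)
  have "cauchy_laguerre_pairing a b f (q_tilde a b m) =
      (\<Sum>i\<le>m. coeff f i * Gamma (a + real i + 1) *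
        (\<Sum>j\<le>m. jacobi_coeff (a + b) m j / (a + b + real i + real j + 1)))"
    unfolding cauchy_laguerre_pairing_eq_moment_sum[OF assms(1-4) deg_q] coeff_q
    by (simp add: sum_distrib_left Gamma_nz mult_ac)
  also have "\<dots> = (\<Sum>i\<le>m. coeff f i * Gamma (a + real i + 1) *
      (pochhammer (- real i) m / pochhammer (a + b + 1 + real i) (Suc m)))"
    by (simp only: jacobi_coeff_moment[OF assms(3)])
  also have "\<dots> = (\<Sum>i\<in>{m}. coeff f i * Gamma (a + real i + 1) *
      (pochhammer (- real i) m / pochhammer (a + b + 1 + real i) (Suc m)))"
    by (rule sum.mono_neutral_right) (auto simp: pochhammer_of_nat_eq_0_lemma)
  finally show ?thesis by (simp add: pochhammer_same)
qed

text \<open>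
  For \<open>l < m\<close> the coefficient of \<open>x\<^sup>m\<close> in \<open>p_tilde\<close> is zero; the case \<open>l > m\<close> is the same
  statement with the two variables exchanged.
\<close>
lemma pairing_p_tilde_q_tilde:
  assumes "a > -1" and "b > -1" and "a + b > -1"
  shows "cauchy_laguerre_pairing a b (p_tilde a b l) (q_tilde a b m) =
         (if l = m then 1 / (2 * real m + (a + b) + 1) else 0)"
proof -
  have ba: "b + a > -1" "b + a = a + b" using assms(3) by simp_all
  have below: "cauchy_laguerre_pairing a b (p_tilde a b l) (q_tilde a b m) = 0"
    if "a > -1" "b > -1" "a + b > -1" "l < m" for a b l m
  proof -
    have "degree (p_tilde a b l) < m"
      using degree_p_tilde_le[of a b l] that(4) by simp
    then show ?thesis
      using pairing_q_tilde[OF that(1-3), of "p_tilde a b l" m] by (simp add: coeff_eq_0)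
  qed
  consider "l < m" | "m < l" | "l = m" by linarith
  then show ?thesis
  proof cases
    case 2
    then show ?thesis
      using below[OF assms(2,1) ba(1) 2]
      by (simp add: cauchy_laguerre_pairing_commute[OF assms] q_tilde_conv_p_tilde)
  next
    case 3
    define P where "P = pochhammer (a + b + 1 + real m) m"
    have P: "P > 0"
      unfolding P_def using assms(3) by (intro pochhammer_pos) simp
    have Suc: "pochhammer (a + b + 1 + real m) (Suc m) = P * (2 * real m + (a + b) + 1)"
      by (simp add: P_def pochhammer_Suc)
    have "Gamma (a + real m + 1) \<noteq> 0"
      using Gamma_shift_pos[OF assms(1), of m] by simp
    then show ?thesis
      using pairing_q_tilde[OF assms degree_p_tilde_le[of a b m]] 3 P
      unfolding coeff_p_tilde[OF assms(3)] jacobi_coeff_def Suc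
      by (simp flip: P_def power_add mult_2)
  qed (use below[OF assms] in simp)
qed

text \<open>
  The leading coefficient is symmetric in \<open>a\<close> and \<open>b\<close>, so the normalized \<open>p_tilde\<close> and
  \<open>q_tilde\<close> share it. This is what dictates the Gamma quotients in \<open>pi_const\<close> and
  \<open>eta_const\<close>.
\<close>
lemma normalized_p_tilde_lead_coeff:
  assumes "a > -1" and "b > -1" and "a + b > -1"
  shows "degree (smult ((-1) ^ n * pi_const a b n) (p_tilde a b n)) = n \<and>
    lead_coeff (smult ((-1) ^ n * pi_const a b n) (p_tilde a b n)) =
      sqrt (2 * real n + (a + b) + 1) * (pochhammer (a + b + 1 + real n) n / fact n) /
        (sqrt (Gamma (a + real n + 1)) * sqrt (Gamma (b + real n + 1)))"
proof -
  let ?f = "smult ((-1) ^ n * pi_const a b n) (p_tilde a b n)"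
  have Gamma_pos: "Gamma (a + real n + 1) > 0" "Gamma (b + real n + 1) > 0"
    using assms by (simp_all add: Gamma_shift_pos)
  have poch: "pochhammer (a + b + 1 + real n) n > 0"
    using assms by (intro pochhammer_pos) simp
  have "coeff ?f n = pi_const a b n / Gamma (a + real n + 1) *
      (pochhammer (a + b + 1 + real n) n / fact n)"
    by (simp add: coeff_p_tilde[OF assms(3)] jacobi_coeff_def mult.assoc
        mult.left_commute[of "pi_const a b n"])
  also have "pi_const a b n / Gamma (a + real n + 1) = sqrt (2 * real n + (a + b) + 1) /
        (sqrt (Gamma (a + real n + 1)) * sqrt (Gamma (b + real n + 1)))"
  proof -
    have "sqrt (Gamma (a + real n + 1)) / Gamma (a + real n + 1) = 1 / sqrt (Gamma (a + real n + 1))"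
      using Gamma_pos(1) by (simp add: real_div_sqrt field_simps)
    moreover have "pi_const a b n / Gamma (a + real n + 1) =
        sqrt (2 * real n + (a + b) + 1) / sqrt (Gamma (b + real n + 1)) *
          (sqrt (Gamma (a + real n + 1)) / Gamma (a + real n + 1))"
      by (simp add: pi_const_def real_sqrt_divide)
    ultimately show ?thesis by (simp add: mult.commute)
  qed
  finally have coeff: "coeff ?f n = sqrt (2 * real n + (a + b) + 1) /
        (sqrt (Gamma (a + real n + 1)) * sqrt (Gamma (b + real n + 1))) *
        (pochhammer (a + b + 1 + real n) n / fact n)" .
  then have "coeff ?f n \<noteq> 0"
    using assms poch Gamma_pos[THEN less_imp_neq, THEN not_sym] by simp
  then have "degree ?f = n"
    using degree_p_tilde_le[of a b n] degree_smult_le[of "(-1) ^ n * pi_const a b n" "p_tilde a b n"]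
    by (intro order.antisym le_degree) auto
  with coeff show ?thesis by (simp add: mult_ac)
qed

lemma biorthonormal_explicit:
  assumes "a > -1" and "b > -1" and "a + b > -1"
  shows "cauchy_laguerre_biorthonormal a b
           (\<lambda>n. smult ((-1) ^ n * pi_const a b n) (p_tilde a b n))
           (\<lambda>n. smult ((-1) ^ n * eta_const a b n) (q_tilde a b n))"
    (is "cauchy_laguerre_biorthonormal a b ?p ?q")
proof -
  have ba: "b + a > -1" "b + a = a + b" using assms(3) by simp_all
  have "pi_const a b n * eta_const a b n = 2 * real n + (a + b) + 1" for n
  proof -
    have "Gamma (a + real n + 1) \<noteq> 0" "Gamma (b + real n + 1) \<noteq> 0"
      using Gamma_shift_pos[OF assms(1), of n] Gamma_shift_pos[OF assms(2), of n] by linarith+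
    then show ?thesis
      using assms by (simp add: pi_const_def eta_const_def real_sqrt_divide)
  qed
  then have "cauchy_laguerre_pairing a b (?p l) (?q m) = (if l = m then 1 else 0)" for l m
    using assms
    by (simp add: cauchy_laguerre_pairing_smult[OF assms] pairing_p_tilde_q_tilde[OF assms]
        mult.assoc mult.left_commute[of "pi_const a b m"])
  moreover have "degree (?q n) = n" for n
    unfolding q_tilde_conv_p_tilde eta_const_conv_pi_const
    by (rule normalized_p_tilde_lead_coeff[OF assms(2,1) ba(1), THEN conjunct1])
  moreover have "lead_coeff (?p n) = lead_coeff (?q n)" for n
    unfolding q_tilde_conv_p_tilde eta_const_conv_pi_const
      normalized_p_tilde_lead_coeff[OF assms, THEN conjunct2]
      normalized_p_tilde_lead_coeff[OF assms(2,1) ba(1), THEN conjunct2] ba(2)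
    by (simp only: mult.commute)
  moreover have "degree (?p n) = n" for n
    by (rule normalized_p_tilde_lead_coeff[OF assms, THEN conjunct1])
  moreover have "lead_coeff (?p n) > 0" for n
    unfolding normalized_p_tilde_lead_coeff[OF assms, THEN conjunct2]
    using assms by (simp add: Gamma_shift_pos pochhammer_pos)
  ultimately show ?thesis
    unfolding cauchy_laguerre_biorthonormal_def by blast
qed

text \<open>
  The weight contributes \<open>\<Gamma>(a+j+1)\<close> to the \<open>j\<close>-th term and thereby restores the Jacobi
  polynomial, evaluated at \<open>t = 1\<close>; the two signs \<open>(-1)\<^sup>n\<close> cancel.
\<close>
lemma integral_laguerre_weight_p_tilde:
  assumes "a > -1" and "a + b > -1"
  shows "(LBINT x:{0<..}. x powr a * exp (- x) * poly (smult ((-1) ^ n * c) (p_tilde a b n)) x) = c"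
proof -
  have Gamma_nz: "Gamma (a + real j + 1) \<noteq> 0" for j
    using Gamma_shift_pos[OF assms(1), of j] by simp
  have "degree (smult ((-1) ^ n * c) (p_tilde a b n)) \<le> n"
    by (rule order.trans[OF degree_smult_le degree_p_tilde_le])
  from integral_laguerre_weight_poly[OF assms(1) this] show ?thesis
    by (simp add: coeff_p_tilde[OF assms(2)] Gamma_nz sum_jacobi_coeff
        flip: sum_distrib_left power_add mult_2)
qed

theorem theorem5p2:
  fixes a b :: real
  assumes "a > -1" and "b > -1" and "a + b > -1"
  shows "(\<exists>p q. cauchy_laguerre_biorthonormal a b p q) \<and>
    (\<forall>p q. cauchy_laguerre_biorthonormal a b p q \<longrightarrow>
      (\<forall>n. p n = smult ((-1) ^ n * pi_const a b n) (p_tilde a b n) \<and>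
           q n = smult ((-1) ^ n * eta_const a b n) (q_tilde a b n) \<and>
           pi_const a b n = (LBINT x:{0<..}. x powr a * exp (- x) * poly (p n) x) \<and>
           eta_const a b n = (LBINT y:{0<..}. y powr b * exp (- y) * poly (q n) y)))"
proof (intro conjI allI impI)
  have ba: "b + a > -1" using assms(3) by simp
  note explicit = biorthonormal_explicit[OF assms]
  then show "\<exists>p q. cauchy_laguerre_biorthonormal a b p q" by blast
  fix p q n
  assume bi: "cauchy_laguerre_biorthonormal a b p q"
  show p: "p n = smult ((-1) ^ n * pi_const a b n) (p_tilde a b n)"
    by (rule biorthonormal_unique_left[OF assms bi explicit])
  show q: "q n = smult ((-1) ^ n * eta_const a b n) (q_tilde a b n)"
    by (rule biorthonormal_unique_left[OF assms(2,1) ba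
          biorthonormal_swap[OF assms bi] biorthonormal_swap[OF assms explicit]])
  show "pi_const a b n = (LBINT x:{0<..}. x powr a * exp (- x) * poly (p n) x)"
    unfolding p by (rule integral_laguerre_weight_p_tilde[OF assms(1,3), symmetric])
  show "eta_const a b n = (LBINT y:{0<..}. y powr b * exp (- y) * poly (q n) y)"
    unfolding q q_tilde_conv_p_tilde
    by (rule integral_laguerre_weight_p_tilde[OF assms(2) ba, symmetric])
qed

end
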